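(* Consider the following seven finite collections of trees: (a) $T_{3,k,k}$ for $4\le k\le 12$; (b) $T_{3,k,k+1}$ for $4\le k\le 9$; (c) $T_{3,k,k+2}$ for $4\le k\le 9$; (d) $T^{\ast}_{3,k,k+1}$ for $3\le k\le 8$; (e) $T^{\ast}_{3,k-1,k+1}$ for $4\le k\le 9$; (f) $T^{\ast}_{3,k,k}$ for $4\le k\le 9$; (g) $T^{\ast}_{3,k,k+3}$ for $4\le k\le 9$. For every tree $T$ in any of these collections and every nonedge $e$ of $T$ (a pair of distinct nonadjacent vertices), the graph $T+e$ has a unimodal independence polynomial. However, in none of these collections is non-log-concavity universally preserved: each of the seven collections contains a tree $T$ with a nonedge $e$ such that the independence polynomial of $T+e$ is log-concave.
   Context: Graphs are finite and simple. $I(G;x)=\sum_{j=0}^{\alpha(G)}s_j(G)x^j$ is the independence polynomial, where $s_j(G)$ counts independent sets of size $j$ and $\alpha(G)$ is the independence number. A polynomial with nonnegative coefficients $(a_0,\dots,a_d)$ is unimodal if $a_0\le\cdots\le a_m\ge\cdots\ge a_d$ for some $m$, and log-concave if $a_i^2\ge a_{i-1}a_{i+1}$ for $1\le i\le d-1$. $T+e$ is $T$ with the edge $e$ added. A $P_2$-arm at a vertex $v$ is a path $v\,a\,b$ with edges $va$, $ab$ and new vertices $a,b$. The tree $T_{3,m,n}$ has a root $v_0$ with exactly three children $v_1,v_2,v_3$, where $v_1$ carries three $P_2$-arms, $v_2$ carries $m$ $P_2$-arms, and $v_3$ carries $n$ $P_2$-arms; there are no other vertices or edges. The tree $T^{\ast}_{3,m,n}$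 is obtained from $T_{3,m,n}$ by replacing one of the three $P_2$-arms at $v_1$ by a pendant $P_4$, i.e. a path $v_1\,a\,b\,c\,d$ with four new vertices $a,b,c,d$ attached to $v_1$ at the endpoint $a$. *)

theory Defs
  imports "HOL-Computational_Algebra.Polynomial"
begin

section \<open>Finite simple graphs and independence polynomials\<close>

record 'a ugraph =
  verts :: "'a set"
  edges :: "'a set set"

definition simple_graph :: "'a ugraph \<Rightarrow> bool" where
  "simple_graph G \<longleftrightarrow> finite (verts G) \<and> (\<forall>e\<in>edges G. e \<subseteq> verts G \<and> card e = 2)"

definition nonedge :: "'a ugraph \<Rightarrow> 'a \<Rightarrow> 'a \<Rightarrow> bool" where
  "nonedge G u v \<longleftrightarrow> u \<in> verts G \<and> v \<in> verts G \<and> u \<noteq> v \<and> {u, v} \<notin> edges G"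

definition add_edge :: "'a ugraph \<Rightarrow> 'a \<Rightarrow> 'a \<Rightarrow> 'a ugraph" where
  "add_edge G u v = \<lparr>verts = verts G, edges = insert {u, v} (edges G)\<rparr>"

definition independent :: "'a ugraph \<Rightarrow> 'a set \<Rightarrow> bool" where
  "independent G S \<longleftrightarrow> S \<subseteq> verts G \<and> (\<forall>u\<in>S. \<forall>v\<in>S. {u, v} \<notin> edges G)"

definition num_indep :: "'a ugraph \<Rightarrow> nat \<Rightarrow> nat" where
  "num_indep G j = card {S. independent G S \<and> card S = j}"

definition indep_number :: "'a ugraph \<Rightarrow> nat" where
  "indep_number G = Max {card S | S. independent G S}"

definition indep_poly :: "'a ugraph \<Rightarrow> nat poly" where
  "indep_poly G = (\<Sum>j\<le>indep_number G. monom (num_indep G j) j)"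

section \<open>Unimodality and log-concavity\<close>

text \<open>Coefficients are natural numbers, hence nonnegative; \<open>a_d\<close> is the leading coefficient.\<close>

definition unimodal :: "nat poly \<Rightarrow> bool" where
  "unimodal p \<longleftrightarrow> (\<exists>m\<le>degree p.
     (\<forall>i<m. coeff p i \<le> coeff p (Suc i)) \<and>
     (\<forall>i. m \<le> i \<and> i < degree p \<longrightarrow> coeff p (Suc i) \<le> coeff p i))"

definition log_concave :: "nat poly \<Rightarrow> bool" where
  "log_concave p \<longleftrightarrow> (\<forall>i. 1 \<le> i \<and> i < degree p \<longrightarrow>
     coeff p (i - 1) * coeff p (i + 1) \<le> (coeff p i)\<^sup>2)"

section \<open>The trees\<close>

text \<open>
  The root has one child \<open>Branch i\<close> for each entry of \<open>L\<close>.  The \<open>j\<close>-th entry of the list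
  \<open>L ! i\<close> is the number \<open>l\<close> of new vertices on the \<open>j\<close>-th path
  \<open>Branch i, Arm i j 0, \<dots>, Arm i j (l - 1)\<close> attached to \<open>Branch i\<close>.  So an entry \<open>2\<close> is a
  \<open>P\<^sub>2\<close>-arm, and an entry \<open>4\<close> is a pendant \<open>P\<^sub>4\<close>.  The vertices \<open>v\<^sub>1, v\<^sub>2, v\<^sub>3\<close> are
  \<open>Branch 0, Branch 1, Branch 2\<close>.
\<close>

datatype vertex = Root | Branch nat | Arm nat nat nat

definition arm_tree :: "nat list list \<Rightarrow> vertex ugraph" where
  "arm_tree L = \<lparr>
     verts = {Root} \<union> {Branch i | i. i < length L} \<union>
       {Arm i j p | i j p. i < length L \<and> j < length (L ! i) \<and> p < L ! i ! j},
     edges = {{Root, Branch i} | i. i < length L} \<union>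
       {{Branch i, Arm i j 0} | i j. i < length L \<and> j < length (L ! i) \<and> 0 < L ! i ! j} \<union>
       {{Arm i j p, Arm i j (Suc p)} | i j p.
          i < length L \<and> j < length (L ! i) \<and> Suc p < L ! i ! j}\<rparr>"

definition T3 :: "nat \<Rightarrow> nat \<Rightarrow> vertex ugraph" where
  "T3 m n = arm_tree [[2, 2, 2], replicate m 2, replicate n 2]"

definition T3_star :: "nat \<Rightarrow> nat \<Rightarrow> vertex ugraph" where
  "T3_star m n = arm_tree [[2, 2, 4], replicate m 2, replicate n 2]"

lemma simple_graph_arm_tree: "simple_graph (arm_tree L)"
proof -
  have *: "{Arm i j p | i j p. i < length L \<and> j < length (L ! i) \<and> p < L ! i ! j} =
     (\<Union>i<length L. \<Union>j<length (L ! i). Arm i j ` {..<L ! i ! j})"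
    by auto
  have "finite (verts (arm_tree L))"
    unfolding arm_tree_def by (simp add: *)
  then show ?thesis
    unfolding simple_graph_def by (auto simp: arm_tree_def)
qed

lemma simple_graph_add_edge:
  "simple_graph G \<Longrightarrow> nonedge G u v \<Longrightarrow> simple_graph (add_edge G u v)"
  by (auto simp: simple_graph_def nonedge_def add_edge_def)

end

theory Submission
  imports Defs
begin

text \<open>
  The independent sets of \<open>T + uv\<close> are those of \<open>T\<close> that do not contain both \<open>u\<close> and \<open>v\<close>, so
  \<open>I(T + uv) = I(T) - h\<close> where \<open>h\<close> counts the independent sets of \<open>T\<close> containing \<open>u\<close> and \<open>v\<close>.
  Once the root and the branch vertices are decided, \<open>h\<close> factors over the arms, and an arm only
  sees which of its own vertices are marked, i.e. equal to \<open>u\<close> or \<open>v\<close>.  As all arms of length 2 at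
  a branch are alike, each tree has fewer than a hundred possible \<open>h\<close>, which are multiplied out
  from the factors \<open>1 + 2 x\<close> and \<open>1 + x\<close> and checked by computation.
\<close>

section \<open>Weighted sums over independent sets\<close>

definition stable :: "'v set set \<Rightarrow> 'v set \<Rightarrow> bool" where
  "stable E S \<longleftrightarrow> (\<forall>u\<in>S. \<forall>v\<in>S. {u, v} \<notin> E)"

text \<open>Each vertex has two weights, \<open>b v\<close> if chosen and \<open>a v\<close> if not.
  A zero of \<open>a\<close> forces a vertex into the set and a zero of \<open>b\<close> keeps it
  out, so marks and excluded neighbours need no change of \<open>E\<close> or
  \<open>V\<close>.\<close>

definition wsum :: "'v set set \<Rightarrow> ('v \<Rightarrow> 'b::comm_semiring_1) \<Rightarrow> ('v \<Rightarrow> 'b) \<Rightarrow> 'v set \<Rightarrow> 'b" where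
  "wsum E a b V = (\<Sum>S | S \<subseteq> V \<and> stable E S. (\<Prod>v\<in>V - S. a v) * (\<Prod>v\<in>S. b v))"

lemma wsum_empty [simp]: "wsum E a b {} = 1"
proof -
  have "{S. S \<subseteq> {} \<and> stable E S} = {{}}"
    by (auto simp: stable_def)
  then show ?thesis
    by (simp add: wsum_def)
qed

lemma wsum_cong:
  assumes "\<And>v. v \<in> V \<Longrightarrow> a v = a' v" and "\<And>v. v \<in> V \<Longrightarrow> b v = b' v"
  shows "wsum E a b V = wsum E a' b' V"
  unfolding wsum_def using assms
  by (intro sum.cong refl arg_cong2[where f = "(*)"] prod.cong) auto

text \<open>Splits by whether \<open>v\<close> is chosen. If it is, its neighbours are excluded by
  giving them weight 0, so the recursion stays within \<open>wsum\<close> for the same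
  \<open>E\<close>. The absence of the loop \<open>{v}\<close> is what \<open>stable\<close> asks of
  the pair \<open>(v, v)\<close>.\<close>

lemma wsum_insert:
  assumes "finite V" "v \<notin> V" "{v} \<notin> E"
  shows "wsum E a b (insert v V) =
    a v * wsum E a b V + b v * wsum E a (\<lambda>w. if {v, w} \<in> E then 0 else b w) V"
proof -
  let ?b = "\<lambda>w. if {v, w} \<in> E then 0 else b w"
  let ?t = "\<lambda>S. (\<Prod>w\<in>insert v V - S. a w) * (\<Prod>w\<in>S. b w)"
  define A where "A = {S. S \<subseteq> V \<and> stable E S}"
  define B where "B = {S\<in>A. \<forall>w\<in>S. {v, w} \<notin> E}"
  have fin: "finite A" "B \<subseteq> A"
    using assms by (auto simp: A_def B_def)
  have fB: "finite B"
    using fin finite_subset by blast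
  have inj: "inj_on (insert v) B"
    using assms(2) by (auto simp: inj_on_def A_def B_def)
  have split: "{S. S \<subseteq> insert v V \<and> stable E S} = A \<union> insert v ` B"
  proof (intro set_eqI iffI)
    fix S assume S: "S \<in> {S. S \<subseteq> insert v V \<and> stable E S}"
    show "S \<in> A \<union> insert v ` B"
    proof (cases "v \<in> S")
      case True
      then have "S = insert v (S - {v})" "S - {v} \<in> B"
        using S by (auto simp: A_def B_def stable_def)
      then show ?thesis
        by blast
    qed (use S in \<open>auto simp: A_def\<close>)
  next
    fix S assume "S \<in> A \<union> insert v ` B"
    then show "S \<in> {S. S \<subseteq> insert v V \<and> stable E S}"
      using assms(3) by (auto simp: A_def B_def stable_def insert_commute)
  qed
  have "wsum E a b (insert v V) = (\<Sum>S\<in>A. ?t S) + (\<Sum>S\<in>insert v ` B. ?t S)"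
    unfolding wsum_def split using fin fB assms(2)
    by (intro sum.union_disjoint) (auto simp: A_def)
  also have "(\<Sum>S\<in>A. ?t S) = a v * wsum E a b V"
    unfolding wsum_def A_def[symmetric] sum_distrib_left
  proof (rule sum.cong)
    fix S assume "S \<in> A"
    then have "insert v V - S = insert v (V - S)"
      using assms(2) by (auto simp: A_def)
    then show "?t S = a v * ((\<Prod>w\<in>V - S. a w) * (\<Prod>w\<in>S. b w))"
      using assms by (simp add: mult.assoc)
  qed simp
  also have "(\<Sum>S\<in>insert v ` B. ?t S) = (\<Sum>S\<in>B. ?t (insert v S))"
    using inj by (simp add: sum.reindex)
  also have "\<dots> = (\<Sum>S\<in>B. b v * ((\<Prod>w\<in>V - S. a w) * (\<Prod>w\<in>S. ?b w)))"
  proof (rule sum.cong)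
    fix S assume "S \<in> B"
    then have "S \<subseteq> V" and "\<And>w. w \<in> S \<Longrightarrow> {v, w} \<notin> E"
      by (auto simp: A_def B_def)
    moreover from this have "insert v V - insert v S = V - S" "v \<notin> S" "finite S"
      using assms finite_subset by auto
    ultimately show "?t (insert v S) = b v * ((\<Prod>w\<in>V - S. a w) * (\<Prod>w\<in>S. ?b w))"
      by (simp add: ac_simps)
  qed simp
  \<comment> \<open>A set with a neighbour of \<open>v\<close> has a factor 0, so the sum may run
    over all of \<open>A\<close> again.\<close>
  also have "\<dots> = (\<Sum>S\<in>A. b v * ((\<Prod>w\<in>V - S. a w) * (\<Prod>w\<in>S. ?b w)))"
  proof (rule sum.mono_neutral_left)
    show "\<forall>S\<in>A - B. b v * ((\<Prod>w\<in>V - S. a w) * (\<Prod>w\<in>S. ?b w)) = 0"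
    proof
      fix S assume "S \<in> A - B"
      then have "finite S" "\<exists>w\<in>S. ?b w = 0"
        using assms finite_subset by (auto simp: A_def B_def)
      then show "b v * ((\<Prod>w\<in>V - S. a w) * (\<Prod>w\<in>S. ?b w)) = 0"
        by (simp add: prod_zero del: if_False)
    qed
  qed (use fin in auto)
  also have "\<dots> = b v * wsum E a ?b V"
    unfolding wsum_def A_def sum_distrib_left ..
  finally show ?thesis .
qed

text \<open>Without edges between \<open>V\<close> and \<open>W\<close>, a stable set of the union
  is an arbitrary pair of stable sets of the parts, and the weights split accordingly.\<close>

lemma wsum_Un:
  assumes "finite V" "finite W" "V \<inter> W = {}" "\<And>v w. v \<in> V \<Longrightarrow> w \<in> W \<Longrightarrow> {v, w} \<notin> E"
  shows "wsum E a b (V \<union> W) = wsum E a b V * wsum E a b W"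
proof -
  let ?I = "\<lambda>U. {S. S \<subseteq> U \<and> stable E S}"
  let ?t = "\<lambda>U S. (\<Prod>v\<in>U - S. a v) * (\<Prod>v\<in>S. b v)"
  have "wsum E a b V * wsum E a b W = (\<Sum>(S, R)\<in>?I V \<times> ?I W. ?t V S * ?t W R)"
    unfolding wsum_def by (simp add: sum_product sum.cartesian_product)
  also have "\<dots> = (\<Sum>S\<in>?I (V \<union> W). ?t (V \<union> W) S)"
  proof (rule sum.reindex_bij_witness[where i = "\<lambda>S. (S \<inter> V, S \<inter> W)" and j = "\<lambda>(S, R). S \<union> R"])
    fix p assume "p \<in> ?I V \<times> ?I W"
    then obtain S R where p: "p = (S, R)" "S \<subseteq> V" "R \<subseteq> W" "stable E S" "stable E R"
      by auto
    have "V \<union> W - (S \<union> R) = (V - S) \<union> (W - R)"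
      using p assms(3) by auto
    moreover have "finite S" "finite R"
      using p assms(1,2) by (auto intro: finite_subset)
    moreover have "S \<inter> R = {}" "(V - S) \<inter> (W - R) = {}"
      using p assms(3) by auto
    ultimately show "?t (V \<union> W) (case p of (S, R) \<Rightarrow> S \<union> R) = (case p of (S, R) \<Rightarrow> ?t V S * ?t W R)"
      using p assms by (simp add: prod.union_disjoint ac_simps)
    show "(\<lambda>S. (S \<inter> V, S \<inter> W)) (case p of (S, R) \<Rightarrow> S \<union> R) = p"
      using p assms(3) by auto
    have "{w, v} \<notin> E" if "v \<in> V" "w \<in> W" for v w
      using assms(4)[OF that] by (simp add: insert_commute)
    with p assms(4) show "(case p of (S, R) \<Rightarrow> S \<union> R) \<in> ?I (V \<union> W)"
      by (simp add: stable_def) blast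
  qed (auto simp: stable_def)
  finally show ?thesis
    by (simp only: wsum_def)
qed

lemma wsum_UN:
  assumes "finite I" "\<And>i. i \<in> I \<Longrightarrow> finite (V i)"
    and "\<And>i j v w. \<lbrakk>i \<in> I; j \<in> I; i \<noteq> j; v \<in> V i; w \<in> V j\<rbrakk> \<Longrightarrow> v \<noteq> w \<and> {v, w} \<notin> E"
  shows "wsum E a b (\<Union>i\<in>I. V i) = (\<Prod>i\<in>I. wsum E a b (V i))"
  using assms
proof (induction I rule: finite_induct)
  case (insert i I)
  have "wsum E a b (V i \<union> (\<Union>i\<in>I. V i)) = wsum E a b (V i) * wsum E a b (\<Union>i\<in>I. V i)"
  proof (rule wsum_Un)
    show "V i \<inter> (\<Union>i\<in>I. V i) = {}"
      using insert.prems(2)[of i] insert.hyps(2) by blast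
    show "{v, w} \<notin> E" if "v \<in> V i" "w \<in> (\<Union>i\<in>I. V i)" for v w
      using insert.prems(2)[of i _ v w] insert.hyps(2) that by auto
  qed (use insert in auto)
  moreover have "wsum E a b (\<Union>i\<in>I. V i) = (\<Prod>i\<in>I. wsum E a b (V i))"
    using insert.prems by (intro insert.IH) blast+
  ultimately show ?case
    using insert.hyps by simp
qed simp

section \<open>Independence polynomials\<close>

lemma finite_independent: "finite (verts G) \<Longrightarrow> finite {S. independent G S}"
  by (rule finite_subset[of _ "Pow (verts G)"]) (auto simp: independent_def)

text \<open>No independent set is larger than \<open>indep_number G\<close>, so cutting the sum
  there loses no coefficient.\<close>

lemma coeff_indep_poly:
  assumes "finite (verts G)"
  shows "coeff (indep_poly G) j = num_indep G j"
proof -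
  have "num_indep G j = 0" if "j > indep_number G"
  proof -
    have le: "card S \<le> indep_number G" if "independent G S" for S
      unfolding indep_number_def using that finite_independent[OF assms]
      by (intro Max_ge) (auto simp: Setcompr_eq_image)
    then have none: "{S. independent G S \<and> card S = j} = {}"
      using that by (auto dest!: le)
    show ?thesis
      unfolding num_indep_def none by simp
  qed
  then show ?thesis
    by (auto simp: indep_poly_def coeff_sum coeff_monom)
qed

text \<open>Integer coefficients, because a new edge acts by subtraction.\<close>

definition X :: "int poly" where "X = [:0, 1:]"

lemma X_power: "X ^ n = monom 1 n"
  by (simp add: X_def monom_altdef)

lemma indep_poly_wsum:
  assumes "finite (verts G)"
  shows "map_poly int (indep_poly G) = wsum (edges G) (\<lambda>_. 1) (\<lambda>_. X) (verts G)"
proof (rule poly_eqI)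
  fix j
  have I: "{S. S \<subseteq> verts G \<and> stable (edges G) S} = {S. independent G S}"
    by (simp add: stable_def independent_def)
  have "coeff (wsum (edges G) (\<lambda>_. 1) (\<lambda>_. X) (verts G)) j =
      (\<Sum>S | independent G S. if card S = j then 1 else 0)"
    by (simp add: wsum_def I X_power coeff_sum coeff_monom)
  also have "\<dots> = int (num_indep G j)"
    using finite_independent[OF assms]
    by (simp add: num_indep_def sum.If_cases Int_def)
  finally show "coeff (map_poly int (indep_poly G)) j =
      coeff (wsum (edges G) (\<lambda>_. 1) (\<lambda>_. X) (verts G)) j"
    by (simp add: coeff_map_poly coeff_indep_poly assms)
qed

section \<open>Forcing marked vertices into independent sets\<close>

definition out :: "'v set \<Rightarrow> 'v \<Rightarrow> int poly" where
  "out M v = (if v \<in> M then 0 else 1)"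

text \<open>With weights \<^term>\<open>out M\<close> outside of \<open>S\<close>, only the sets \<open>S\<close> that contain \<open>M\<close> contribute.\<close>

definition ipoly :: "'v ugraph \<Rightarrow> 'v set \<Rightarrow> int poly" where
  "ipoly G M = wsum (edges G) (out M) (\<lambda>_. X) (verts G)"

lemma indep_poly_eq_ipoly:
  "finite (verts G) \<Longrightarrow> map_poly int (indep_poly G) = ipoly G {}"
  by (simp add: indep_poly_wsum ipoly_def out_def cong: wsum_cong)

lemma indep_poly_add_edge:
  assumes "finite (verts G)" "nonedge G u v"
  shows "map_poly int (indep_poly (add_edge G u v)) = ipoly G {} - ipoly G {u, v}"
proof -
  let ?V = "verts G" and ?E = "edges G"
  let ?A = "{S. S \<subseteq> ?V \<and> stable ?E S}" and ?B = "{S. S \<subseteq> ?V \<and> stable (insert {u, v} ?E) S}"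
  have uv: "u \<in> ?V" "v \<in> ?V" "u \<noteq> v"
    using assms(2) by (auto simp: nonedge_def)
  have AB: "?B = {S \<in> ?A. \<not> {u, v} \<subseteq> S}"
    using uv by (auto simp: stable_def doubleton_eq_iff)
  have fin: "finite ?A"
    using assms by simp
  \<comment> \<open>An endpoint outside \<open>S\<close> gives a factor 0, so this product is the
    indicator of both endpoints being chosen.\<close>
  have "(\<Prod>w\<in>?V - S. out {u, v} w) = (if {u, v} \<subseteq> S then 1 else 0)" if "S \<subseteq> ?V" for S
  proof (cases "{u, v} \<subseteq> S")
    case True
    then show ?thesis
      by (auto simp: out_def intro!: prod.neutral)
  next
    case False
    then have "\<exists>w\<in>?V - S. out {u, v} w = 0"
      using uv by (auto simp: out_def)
    then show ?thesis
      using False assms(1) by (simp add: prod_zero)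
  qed
  then have "ipoly G {u, v} = (\<Sum>S\<in>?A. if {u, v} \<subseteq> S then X ^ card S else 0)"
    unfolding ipoly_def wsum_def by (intro sum.cong) auto
  moreover have "ipoly G {} = (\<Sum>S\<in>?A. X ^ card S)"
    by (simp add: ipoly_def wsum_def out_def)
  moreover have "map_poly int (indep_poly (add_edge G u v)) = (\<Sum>S\<in>?B. X ^ card S)"
    using assms(1) by (simp add: indep_poly_wsum add_edge_def wsum_def)
  moreover have "(\<Sum>S\<in>?B. X ^ card S) = (\<Sum>S\<in>?A. if {u, v} \<subseteq> S then 0 else X ^ card S)"
    unfolding AB using fin by (subst sum.inter_filter) (auto intro!: sum.cong)
  ultimately show ?thesis
    by (auto simp: sum_subtractf[symmetric] intro!: sum.cong)
qed

section \<open>Factorization along an arm tree\<close>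

definition arm_verts :: "nat list list \<Rightarrow> nat \<Rightarrow> nat \<Rightarrow> vertex set" where
  "arm_verts L i j = Arm i j ` {..<L ! i ! j}"

definition branch_verts :: "nat list list \<Rightarrow> nat \<Rightarrow> vertex set" where
  "branch_verts L i = insert (Branch i) (\<Union>j<length (L ! i). arm_verts L i j)"

lemma finite_arm_verts [simp]: "finite (arm_verts L i j)"
  by (simp add: arm_verts_def)

lemma finite_branch_verts [simp]: "finite (branch_verts L i)"
  by (simp add: branch_verts_def)

lemma verts_arm_tree: "verts (arm_tree L) = insert Root (\<Union>i<length L. branch_verts L i)"
  by (auto simp: arm_tree_def branch_verts_def arm_verts_def)

lemma finite_verts_arm_tree [simp]: "finite (verts (arm_tree L))"
  by (simp add: verts_arm_tree)

lemma edges_arm_tree_simps: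
  "{v} \<notin> edges (arm_tree L)"
  "{Root, Branch i} \<in> edges (arm_tree L) \<longleftrightarrow> i < length L"
  "{Root, Arm i j p} \<notin> edges (arm_tree L)"
  "{Branch i, Branch i'} \<notin> edges (arm_tree L)"
  "{Branch i, Arm i' j p} \<in> edges (arm_tree L) \<longleftrightarrow>
     i' = i \<and> p = 0 \<and> i < length L \<and> j < length (L ! i) \<and> 0 < L ! i ! j"
  "{Arm i' j p, Branch i} \<in> edges (arm_tree L) \<longleftrightarrow>
     i' = i \<and> p = 0 \<and> i < length L \<and> j < length (L ! i) \<and> 0 < L ! i ! j"
  "{Arm i j p, Arm i' j' q} \<in> edges (arm_tree L) \<longleftrightarrow>
     i' = i \<and> j' = j \<and> (q = Suc p \<or> p = Suc q) \<and>
     i < length L \<and> j < length (L ! i) \<and> p < L ! i ! j \<and> q < L ! i ! j"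
  by (auto simp: arm_tree_def doubleton_eq_iff)

text \<open>
  For a path attached at its vertex \<open>r\<close>, \<open>arm_avoid\<close> sums over the sets that do not contain \<open>r\<close>,
  and likewise for the branches below.
\<close>

definition arm_all :: "nat list list \<Rightarrow> vertex set \<Rightarrow> nat \<Rightarrow> nat \<Rightarrow> int poly" where
  "arm_all L M i j = wsum (edges (arm_tree L)) (out M) (\<lambda>_. X) (arm_verts L i j)"

definition arm_avoid :: "nat list list \<Rightarrow> vertex set \<Rightarrow> nat \<Rightarrow> nat \<Rightarrow> int poly" where
  "arm_avoid L M i j =
     wsum (edges (arm_tree L)) (out M) (\<lambda>w. if w = Arm i j 0 then 0 else X) (arm_verts L i j)"

definition branch_out :: "nat list list \<Rightarrow> vertex set \<Rightarrow> nat \<Rightarrow> int poly" where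
  "branch_out L M i = out M (Branch i) * (\<Prod>j<length (L ! i). arm_all L M i j)"

definition branch_in :: "nat list list \<Rightarrow> vertex set \<Rightarrow> nat \<Rightarrow> int poly" where
  "branch_in L M i = X * (\<Prod>j<length (L ! i). arm_avoid L M i j)"

text \<open>The weight \<open>c\<close> of the branch vertex is left open: \<open>c = X\<close>
  applies when the root is absent, \<open>c = 0\<close> when the root is chosen and excludes its
  neighbour \<open>Branch i\<close>.\<close>

lemma wsum_branch:
  assumes "i < length L"
  shows "wsum (edges (arm_tree L)) (out M) (\<lambda>w. if w = Branch i then c else X) (branch_verts L i) =
    branch_out L M i + (if c = 0 then 0 else c * (\<Prod>j<length (L ! i). arm_avoid L M i j))"
proof -
  let ?E = "edges (arm_tree L)" and ?U = "\<Union>j<length (L ! i). arm_verts L i j"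
  let ?b = "\<lambda>w. if w = Branch i then c else X"
  have prod: "wsum ?E (out M) b ?U = (\<Prod>j<length (L ! i). wsum ?E (out M) b (arm_verts L i j))" for b
    by (rule wsum_UN) (auto simp: arm_verts_def edges_arm_tree_simps)
  have all: "wsum ?E (out M) ?b (arm_verts L i j) = arm_all L M i j" for j
    unfolding arm_all_def by (rule wsum_cong) (auto simp: arm_verts_def)
  have avoid: "wsum ?E (out M) (\<lambda>w. if {Branch i, w} \<in> ?E then 0 else ?b w) (arm_verts L i j) =
      arm_avoid L M i j" if "j < length (L ! i)" for j
    unfolding arm_avoid_def using that assms
    by (intro wsum_cong) (auto simp: arm_verts_def edges_arm_tree_simps)
  have "wsum ?E (out M) ?b (insert (Branch i) ?U) = out M (Branch i) * wsum ?E (out M) ?b ?U +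
      ?b (Branch i) * wsum ?E (out M) (\<lambda>w. if {Branch i, w} \<in> ?E then 0 else ?b w) ?U"
    by (rule wsum_insert) (auto simp: arm_verts_def edges_arm_tree_simps)
  then show ?thesis
    by (simp add: prod all avoid branch_out_def branch_verts_def)
qed

text \<open>Without the root, every branch is free to use its branch vertex or not; with the root,
  no branch vertex may be used. A marked root kills the first case through
  \<open>out M Root\<close>.\<close>

lemma ipoly_arm_tree:
  "ipoly (arm_tree L) M =
    out M Root * (\<Prod>i<length L. branch_out L M i + branch_in L M i) +
    X * (\<Prod>i<length L. branch_out L M i)"
proof -
  let ?E = "edges (arm_tree L)" and ?U = "\<Union>i<length L. branch_verts L i"
  have prod: "wsum ?E (out M) b ?U = (\<Prod>i<length L. wsum ?E (out M) b (branch_verts L i))" for b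
    by (rule wsum_UN) (auto simp: branch_verts_def arm_verts_def edges_arm_tree_simps)
  have all: "wsum ?E (out M) (\<lambda>_. X) (branch_verts L i) = branch_out L M i + branch_in L M i"
    if "i < length L" for i
    using wsum_branch[OF that, of M X] by (simp add: branch_in_def X_def)
  have avoid: "wsum ?E (out M) (\<lambda>w. if {Root, w} \<in> ?E then 0 else X) (branch_verts L i) =
      branch_out L M i" if "i < length L" for i
  proof -
    have "wsum ?E (out M) (\<lambda>w. if {Root, w} \<in> ?E then 0 else X) (branch_verts L i) =
        wsum ?E (out M) (\<lambda>w. if w = Branch i then 0 else X) (branch_verts L i)"
      using that
      by (intro wsum_cong) (auto simp: branch_verts_def arm_verts_def edges_arm_tree_simps)
    then show ?thesis
      using wsum_branch[OF that, of M 0] by simp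
  qed
  have "wsum ?E (out M) (\<lambda>_. X) (insert Root ?U) = out M Root * wsum ?E (out M) (\<lambda>_. X) ?U +
      X * wsum ?E (out M) (\<lambda>w. if {Root, w} \<in> ?E then 0 else X) ?U"
    by (rule wsum_insert)
      (auto simp: branch_verts_def arm_verts_def edges_arm_tree_simps)
  then show ?thesis
    by (simp add: prod all avoid ipoly_def verts_arm_tree)
qed

section \<open>Polynomials as coefficient lists\<close>

fun add_list :: "int list \<Rightarrow> int list \<Rightarrow> int list" where
  "add_list [] ys = ys"
| "add_list (x # xs) [] = x # xs"
| "add_list (x # xs) (y # ys) = (x + y) # add_list xs ys"

fun diff_list :: "int list \<Rightarrow> int list \<Rightarrow> int list" where
  "diff_list xs [] = xs"
| "diff_list [] (y # ys) = - y # diff_list [] ys"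
| "diff_list (x # xs) (y # ys) = (x - y) # diff_list xs ys"

fun scale_list :: "int \<Rightarrow> int list \<Rightarrow> int list" where
  "scale_list c [] = []"
| "scale_list c (x # xs) = c * x # scale_list c xs"

fun mult_list :: "int list \<Rightarrow> int list \<Rightarrow> int list" where
  "mult_list [] ys = []"
| "mult_list (x # xs) ys = add_list (scale_list x ys) (0 # mult_list xs ys)"

fun power_list :: "int list \<Rightarrow> nat \<Rightarrow> int list" where
  "power_list xs 0 = [1]"
| "power_list xs (Suc n) = mult_list xs (power_list xs n)"

lemma Poly_add_list [simp]: "Poly (add_list xs ys) = Poly xs + Poly ys"
  by (induction xs ys rule: add_list.induct) simp_all

lemma Poly_diff_list [simp]: "Poly (diff_list xs ys) = Poly xs - Poly ys"
  by (induction xs ys rule: diff_list.induct) (simp_all flip: minus_pCons)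

lemma Poly_scale_list [simp]: "Poly (scale_list c xs) = smult c (Poly xs)"
  by (induction xs) simp_all

lemma Poly_mult_list [simp]: "Poly (mult_list xs ys) = Poly xs * Poly ys"
  by (induction xs) simp_all

lemma Poly_power_list [simp]: "Poly (power_list xs n) = Poly xs ^ n"
  by (induction n) simp_all

lemma X_mult: "X * p = pCons 0 p"
  by (simp add: X_def)

section \<open>Deciding unimodality and log-concavity on coefficient lists\<close>

fun nonincreasing :: "int list \<Rightarrow> bool" where
  "nonincreasing [] \<longleftrightarrow> True"
| "nonincreasing [x] \<longleftrightarrow> 0 \<le> x"
| "nonincreasing (x # y # zs) \<longleftrightarrow> (if y \<le> x then nonincreasing (y # zs) else False)"

fun unimodal_list :: "int list \<Rightarrow> bool" where
  "unimodal_list [] \<longleftrightarrow> True"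
| "unimodal_list [x] \<longleftrightarrow> 0 \<le> x"
| "unimodal_list (x # y # zs) \<longleftrightarrow>
     (if x \<le> y then unimodal_list (y # zs) else nonincreasing (y # zs))"

fun log_concave_list :: "int list \<Rightarrow> bool" where
  "log_concave_list (x # y # z # ws) \<longleftrightarrow>
     (if x * z \<le> y * y then log_concave_list (y # z # ws) else False)"
| "log_concave_list _ \<longleftrightarrow> True"

text \<open>Past its end a list continues with zero coefficients; the condition
  \<open>0 \<le> x\<close> on the last entry covers the step to the first of them.\<close>

lemma nonincreasing_coeff:
  "nonincreasing xs \<Longrightarrow> coeff (Poly xs) (Suc i) \<le> coeff (Poly xs) i"
proof (induction xs arbitrary: i rule: nonincreasing.induct)
  case (3 x y zs)
  then show ?case
    by (cases i) (auto split: if_splits simp del: coeff_Poly_eq)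
qed (auto simp: coeff_pCons split: nat.splits)

text \<open>The mode is found by recursion on the tail: an ascent at the head shifts the mode of the
  tail by one, a descent puts the mode at 0.\<close>

lemma unimodal_list_coeff:
  assumes "unimodal_list xs"
  obtains m where "\<And>i. i < m \<Longrightarrow> coeff (Poly xs) i \<le> coeff (Poly xs) (Suc i)"
    and "\<And>i. m \<le> i \<Longrightarrow> coeff (Poly xs) (Suc i) \<le> coeff (Poly xs) i"
  using assms
proof (induction xs arbitrary: thesis rule: unimodal_list.induct)
  case 1
  from "1.prems"(1)[of 0] show ?case
    by simp
next
  case (2 x)
  from "2.prems"(1)[of 0] "2.prems"(2) show ?case
    by (auto simp: coeff_pCons split: nat.splits)
next
  case (3 x y zs)
  show ?case
  proof (cases "x \<le> y")
    case True
    with 3 obtain m where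
      m: "\<And>i. i < m \<Longrightarrow> coeff (Poly (y # zs)) i \<le> coeff (Poly (y # zs)) (Suc i)"
         "\<And>i. m \<le> i \<Longrightarrow> coeff (Poly (y # zs)) (Suc i) \<le> coeff (Poly (y # zs)) i"
      by auto
    show ?thesis
    proof (rule "3.prems"(1)[of "Suc m"])
      show "coeff (Poly (x # y # zs)) i \<le> coeff (Poly (x # y # zs)) (Suc i)" if "i < Suc m" for i
        using m(1)[of "i - 1"] that True by (cases i) auto
      show "coeff (Poly (x # y # zs)) (Suc i) \<le> coeff (Poly (x # y # zs)) i" if "Suc m \<le> i" for i
        using m(2)[of "i - 1"] that by (cases i) auto
    qed
  next
    case False
    with "3.prems"(2) have "nonincreasing (x # y # zs)"
      by simp
    with "3.prems"(1)[of 0] show ?thesis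
      by (meson nonincreasing_coeff less_nat_zero_code)
  qed
qed

text \<open>The index can range over all naturals, since the left-hand side vanishes as soon as
  \<open>i + 2\<close> is past the end of the list.\<close>

lemma log_concave_list_coeff:
  "log_concave_list xs \<longleftrightarrow>
   (\<forall>i. coeff (Poly xs) i * coeff (Poly xs) (i + 2) \<le> (coeff (Poly xs) (i + 1))\<^sup>2)"
proof (induction xs rule: log_concave_list.induct)
  case (1 x y z ws)
  have "(\<forall>i. P i) \<longleftrightarrow> P 0 \<and> (\<forall>i. P (Suc i))" for P :: "nat \<Rightarrow> bool"
    by (metis not0_implies_Suc)
  from this[of "\<lambda>i. coeff (Poly (x # y # z # ws)) i * coeff (Poly (x # y # z # ws)) (i + 2)
      \<le> (coeff (Poly (x # y # z # ws)) (i + 1))\<^sup>2"] show ?case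
    using 1 by (auto simp: power2_eq_square)
qed (auto simp: coeff_pCons split: nat.splits)

lemma coeff_of_map_poly_int: "map_poly int p = Poly xs \<Longrightarrow> int (coeff p i) = coeff (Poly xs) i"
  by (metis coeff_map_poly of_nat_0)

lemma unimodal_of_list:
  assumes "map_poly int p = Poly xs" "unimodal_list xs"
  shows "unimodal p"
proof -
  obtain m where "\<And>i. i < m \<Longrightarrow> coeff p i \<le> coeff p (Suc i)"
      "\<And>i. m \<le> i \<Longrightarrow> coeff p (Suc i) \<le> coeff p i"
    using unimodal_list_coeff[OF assms(2)] coeff_of_map_poly_int[OF assms(1)]
    by (metis of_nat_le_iff)
  then show ?thesis
    \<comment> \<open>The list does not bound \<open>m\<close> by \<open>degree p\<close>. Clipping
      \<open>m\<close> keeps the first condition, and if the clip takes effect the second one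
      becomes vacuous.\<close>
    unfolding unimodal_def by (intro exI[of _ "min m (degree p)"]) auto
qed

lemma log_concave_of_list:
  assumes "map_poly int p = Poly xs"
  shows "log_concave p \<longleftrightarrow> log_concave_list xs"
proof -
  have "log_concave p \<longleftrightarrow> (\<forall>i. coeff p i * coeff p (i + 2) \<le> (coeff p (i + 1))\<^sup>2)"
  proof
    assume *: "log_concave p"
    show "\<forall>i. coeff p i * coeff p (i + 2) \<le> (coeff p (i + 1))\<^sup>2"
    proof
      fix i
      show "coeff p i * coeff p (i + 2) \<le> (coeff p (i + 1))\<^sup>2"
        \<comment> \<open>If \<open>i + 1\<close> is at least the degree, the coefficient at
          \<open>i + 2\<close> is 0.\<close>
        using *[unfolded log_concave_def, rule_format, of "i + 1"]
        by (cases "i + 1 < degree p") (auto simp: coeff_eq_0)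
    qed
  next
    assume *: "\<forall>i. coeff p i * coeff p (i + 2) \<le> (coeff p (i + 1))\<^sup>2"
    show "log_concave p"
      unfolding log_concave_def
    proof (intro allI impI)
      fix i assume "1 \<le> i \<and> i < degree p"
      then show "coeff p (i - 1) * coeff p (i + 1) \<le> (coeff p i)\<^sup>2"
        using *[rule_format, of "i - 1"] by (cases i) auto
    qed
  qed
  also have "\<dots> \<longleftrightarrow> log_concave_list xs"
    unfolding log_concave_list_coeff coeff_of_map_poly_int[OF assms, symmetric]
    by (simp flip: of_nat_mult of_nat_power)
  finally show ?thesis .
qed

section \<open>Candidates graded by the number of marked vertices\<close>

text \<open>The three components are indexed by the number of marks, which is 0, 1 or 2.\<close>

type_synonym 'a graded = "'a list \<times> 'a list \<times> 'a list"

fun grade :: "nat \<Rightarrow> 'a graded \<Rightarrow> 'a list" where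
  "grade t (xs, ys, zs) = (if t = 0 then xs else if t = 1 then ys else zs)"

fun map_graded :: "('a \<Rightarrow> 'b) \<Rightarrow> 'a graded \<Rightarrow> 'b graded" where
  "map_graded f (xs, ys, zs) = (map f xs, map f ys, map f zs)"

fun map2_all :: "('a \<Rightarrow> 'b \<Rightarrow> 'c) \<Rightarrow> 'a list \<Rightarrow> 'b list \<Rightarrow> 'c list" where
  "map2_all f [] ys = []"
| "map2_all f (x # xs) ys = map (f x) ys @ map2_all f xs ys"

text \<open>A Cauchy product in the number of marks, truncated above 2 because only the two ends of
  the new edge are marked.\<close>

fun combine :: "('a \<Rightarrow> 'b \<Rightarrow> 'c) \<Rightarrow> 'a graded \<Rightarrow> 'b graded \<Rightarrow> 'c graded" where
  "combine f (a, b, c) (x, y, z) =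
    (map2_all f a x, map2_all f a y @ map2_all f b x,
     map2_all f a z @ map2_all f b y @ map2_all f c x)"

lemma map2_allI: "x \<in> set xs \<Longrightarrow> y \<in> set ys \<Longrightarrow> f x y \<in> set (map2_all f xs ys)"
  by (induction xs) auto

lemma grade_map_graded: "x \<in> set (grade t G) \<Longrightarrow> f x \<in> set (grade t (map_graded f G))"
  by (cases G) auto

lemma grade_combine:
  assumes "x \<in> set (grade s G)" "y \<in> set (grade t H)" "s + t \<le> 2"
  shows "f x y \<in> set (grade (s + t) (combine f G H))"
proof -
  have "s = 0 \<and> t = 0 \<or> s = 0 \<and> t = 1 \<or> s = 1 \<and> t = 0 \<or>
      s = 0 \<and> t = 2 \<or> s = 1 \<and> t = 1 \<or> s = 2 \<and> t = 0"
    using assms(3) by arith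
  with assms show ?thesis
    by (cases G; cases H) (auto intro: map2_allI)
qed

definition mult_pair :: "int list \<times> int list \<Rightarrow> int list \<times> int list \<Rightarrow> int list \<times> int list" where
  "mult_pair p q = (mult_list (fst p) (fst q), mult_list (snd p) (snd q))"

text \<open>Passes from the view of the branch vertex to that of the root: if the root is absent,
  sets with and without the branch vertex count; if it is chosen, only those without.\<close>

definition total_pair :: "int list \<times> int list \<Rightarrow> int list \<times> int list" where
  "total_pair p = (add_list (fst p) (snd p), fst p)"

text \<open>\<open>r\<close> says that the root is unmarked, and only then may it be left out. The
  \<open>0 #\<close> is the factor \<open>X\<close> of a chosen root.\<close>

definition root_poly :: "bool \<Rightarrow> int list \<times> int list \<Rightarrow> int list" where
  "root_poly r p = add_list (if r then fst p else []) (0 # snd p)"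

text \<open>
  The two components belong to the independent sets without and with the branch vertex.  Unmarked
  arms contribute the polynomials of \<open>P\<^sub>2\<close> and \<open>P\<^sub>1\<close> to them, or of \<open>P\<^sub>4\<close> and \<open>P\<^sub>3\<close> in
  \<open>long_arm\<close>, and \<open>([], [])\<close> stands for adjacent marks.
\<close>

definition short_arms :: "nat \<Rightarrow> (int list \<times> int list) graded" where
  "short_arms n =
    ([(power_list [1, 2] n, 0 # power_list [1, 1] n)],
     [([], 0 # power_list [1, 1] n),
      (0 # power_list [1, 2] (n - 1), []),
      (0 # power_list [1, 2] (n - 1), 0 # 0 # power_list [1, 1] (n - 1))],
     [([], []),
      ([], 0 # 0 # power_list [1, 1] (n - 1)),
      (0 # 0 # power_list [1, 2] (n - 2), []),
      (0 # 0 # power_list [1, 2] (n - 2), 0 # 0 # 0 # power_list [1, 1] (n - 2))])"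

definition long_arm :: "(int list \<times> int list) graded" where
  "long_arm =
    ([([1, 4, 3], [1, 3, 1])],
     [([0, 1, 2], []), ([0, 1, 1], [0, 1, 1]), ([0, 1, 1], [0, 1]), ([0, 1, 2], [0, 1, 1])],
     [([], []), ([0, 0, 1], []), ([0, 0, 1], [0, 0, 1])])"

text \<open>The branch vertex, with its mark and its factor \<open>X\<close>, is accounted for in
  \<open>short_arms\<close>; \<open>long_arm\<close> describes only its own four vertices.\<close>

definition star_arms :: "(int list \<times> int list) graded" where
  "star_arms = combine mult_pair (short_arms 2) long_arm"

text \<open>Component \<open>t\<close> collects candidates for the sum over the independent sets
  that contain all of \<open>t\<close> marked vertices. The outermost factor handles the root:
  \<open>True\<close> costs no mark, \<open>False\<close> one.\<close>

definition tree_polys ::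
    "(int list \<times> int list) graded \<Rightarrow> nat \<Rightarrow> nat \<Rightarrow> int list graded" where
  "tree_polys G m n = combine root_poly ([True], [False], [])
     (combine mult_pair (map_graded total_pair G)
       (combine mult_pair (map_graded total_pair (short_arms m))
         (map_graded total_pair (short_arms n))))"

fun check_unimodal :: "int list graded \<Rightarrow> bool" where
  "check_unimodal (fs, gs, hs) \<longleftrightarrow>
    list_all (\<lambda>f. list_all (\<lambda>h. unimodal_list (diff_list f h)) hs) fs"

text \<open>
  A recursive function instead of \<^const>\<open>list_all\<close> over a lambda term: the simplifier would
  expand the body of the latter for symbolic arguments.
\<close>

fun check_all :: "(int list \<times> int list) graded \<Rightarrow> (nat \<times> nat) list \<Rightarrow> bool" where
  "check_all G [] \<longleftrightarrow> True"
| "check_all G ((m, n) # ps) \<longleftrightarrow>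
     (if check_unimodal (tree_polys G m n) then check_all G ps else False)"

lemma check_all_iff: "check_all G ps \<longleftrightarrow> (\<forall>(m, n)\<in>set ps. check_unimodal (tree_polys G m n))"
  by (induction G ps rule: check_all.induct) auto

text \<open>The nonedge behind this check joins \<open>Branch 1\<close> and \<open>Branch 2\<close>.\<close>

fun check_log_concave ::
    "nat \<Rightarrow> nat \<Rightarrow> (int list \<times> int list) graded \<Rightarrow> int list graded \<Rightarrow> bool" where
  "check_log_concave m n (ps, qs, rs) (fs, gs, hs) \<longleftrightarrow>
    list_all (\<lambda>f. \<not> log_concave_list f \<and>
      list_all (\<lambda>p. log_concave_list (diff_list f
        (0 # 0 # mult_list (fst (total_pair p))
          (mult_list (power_list [1, 1] m) (power_list [1, 1] n))))) ps) fs"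

section \<open>Correctness of the candidates\<close>

definition pair_polys :: "(int list \<times> int list) graded \<Rightarrow> nat \<Rightarrow> (int poly \<times> int poly) set" where
  "pair_polys G t = map_prod Poly Poly ` set (grade t G)"

lemma arm_verts_short: "L ! i ! j = 2 \<Longrightarrow> arm_verts L i j = {Arm i j 0, Arm i j 1}"
  by (auto simp: arm_verts_def)

lemma short_arm:
  assumes "i < length L" "j < length (L ! i)" "L ! i ! j = 2"
  shows "arm_all L M i j = out M (Arm i j 0) * out M (Arm i j 1) +
      out M (Arm i j 0) * X + X * out M (Arm i j 1)"
    and "arm_avoid L M i j = out M (Arm i j 0) * (out M (Arm i j 1) + X)"
  unfolding arm_all_def arm_avoid_def using assms
  by (simp_all add: arm_verts_short wsum_insert edges_arm_tree_simps algebra_simps)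

text \<open>Expanding along the path expresses both sums by the four values of \<open>out\<close>;
  the bound on the marks leaves eleven of the sixteen patterns.\<close>

lemma long_arm_candidates:
  assumes "i < length L" "j < length (L ! i)" "L ! i ! j = 4"
    and "card (M \<inter> arm_verts L i j) \<le> 2"
  shows "(arm_all L M i j, arm_avoid L M i j) \<in> pair_polys long_arm (card (M \<inter> arm_verts L i j))"
proof -
  have V: "arm_verts L i j = {Arm i j 0, Arm i j 1, Arm i j 2, Arm i j 3}"
    using assms(3) by (auto simp: arm_verts_def)
  let ?o = "\<lambda>p. out M (Arm i j p)"
  have all: "arm_all L M i j = ?o 0 * (?o 1 * (?o 2 * (?o 3 + X) + X * ?o 3) + X * ?o 2 * (?o 3 + X)) +
      X * ?o 1 * (?o 2 * (?o 3 + X) + X * ?o 3)"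
    unfolding arm_all_def V using assms
    by (simp add: wsum_insert edges_arm_tree_simps algebra_simps)
  have avoid: "arm_avoid L M i j =
      ?o 0 * (?o 1 * (?o 2 * (?o 3 + X) + X * ?o 3) + X * ?o 2 * (?o 3 + X))"
    unfolding arm_avoid_def V using assms
    by (simp add: wsum_insert edges_arm_tree_simps algebra_simps)
  show ?thesis
    using assms(4) unfolding all avoid V
    by (cases "Arm i j 0 \<in> M"; cases "Arm i j 1 \<in> M"; cases "Arm i j 2 \<in> M";
        cases "Arm i j 3 \<in> M")
      (simp_all add: out_def X_def pair_polys_def long_arm_def Int_insert_right one_pCons)
qed

section \<open>A branch vertex with \<open>P\<^sub>2\<close>-arms\<close>

definition short_verts :: "nat \<Rightarrow> nat \<Rightarrow> vertex set" where
  "short_verts i n = insert (Branch i) (\<Union>j<n. {Arm i j 0, Arm i j 1})"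

definition short_out :: "nat list list \<Rightarrow> vertex set \<Rightarrow> nat \<Rightarrow> nat \<Rightarrow> int poly" where
  "short_out L M i n = out M (Branch i) * (\<Prod>j<n. arm_all L M i j)"

definition short_in :: "nat list list \<Rightarrow> vertex set \<Rightarrow> nat \<Rightarrow> nat \<Rightarrow> int poly" where
  "short_in L M i n = X * (\<Prod>j<n. arm_avoid L M i j)"

text \<open>Meant for the arms at a branch: the unmarked ones all give the same factor
  \<open>c\<close>, and only the marked one differs.\<close>

lemma prod_except_one:
  fixes f :: "'a \<Rightarrow> 'b::comm_monoid_mult"
  assumes "finite I" "k \<in> I" "\<And>j. j \<in> I \<Longrightarrow> j \<noteq> k \<Longrightarrow> f j = c"
  shows "(\<Prod>j\<in>I. f j) = f k * c ^ (card I - 1)"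
proof -
  have "(\<Prod>j\<in>I - {k}. f j) = (\<Prod>j\<in>I - {k}. c)"
    using assms by (intro prod.cong) auto
  then show ?thesis
    using assms by (simp add: prod.remove[of I k])
qed

lemma prod_except_two:
  fixes f :: "'a \<Rightarrow> 'b::comm_monoid_mult"
  assumes "finite I" "k \<in> I" "l \<in> I" "k \<noteq> l" "\<And>j. j \<in> I \<Longrightarrow> j \<noteq> k \<Longrightarrow> j \<noteq> l \<Longrightarrow> f j = c"
  shows "(\<Prod>j\<in>I. f j) = f k * f l * c ^ (card I - 2)"
proof -
  have "(\<Prod>j\<in>I - {k}. f j) = f l * c ^ (card (I - {k}) - 1)"
    using assms by (intro prod_except_one) auto
  then show ?thesis
    using assms by (simp add: prod.remove[of I k] mult.assoc numeral_2_eq_2)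
qed

text \<open>\<open>n\<close> may be smaller than the number of arms, so that the same analysis
  serves a branch with only arms of length 2 and the first two arms of
  \<open>[2, 2, 4]\<close>.\<close>

locale short_branch =
  fixes L :: "nat list list" and i n :: nat
  assumes i: "i < length L" and n: "n \<le> length (L ! i)" "\<And>j. j < n \<Longrightarrow> L ! i ! j = 2"
begin

lemma arm:
  assumes "j < n"
  shows "arm_all L M i j = out M (Arm i j 0) * out M (Arm i j 1) +
      out M (Arm i j 0) * X + X * out M (Arm i j 1)"
    and "arm_avoid L M i j = out M (Arm i j 0) * (out M (Arm i j 1) + X)"
  using assms i n short_arm[of i L j M] by simp_all

lemma out_short: "v \<in> short_verts i n \<Longrightarrow> out M v = out (M \<inter> short_verts i n) v"
  by (simp add: out_def)

text \<open>Both factors look only at marks inside \<open>short_verts i n\<close>. So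
  \<open>M\<close> may be replaced by its trace there, which is small enough for a case
  distinction.\<close>

lemma restrict:
  "short_out L M i n = short_out L (M \<inter> short_verts i n) i n"
  "short_in L M i n = short_in L (M \<inter> short_verts i n) i n"
proof -
  have "out M (Branch i) = out (M \<inter> short_verts i n) (Branch i)"
    by (rule out_short) (simp add: short_verts_def)
  moreover have "arm_all L M i j = arm_all L (M \<inter> short_verts i n) i j"
      "arm_avoid L M i j = arm_avoid L (M \<inter> short_verts i n) i j" if "j < n" for j
    using that out_short[of "Arm i j 0" M] out_short[of "Arm i j 1" M]
    by (auto simp: arm short_verts_def)
  ultimately show "short_out L M i n = short_out L (M \<inter> short_verts i n) i n"
      "short_in L M i n = short_in L (M \<inter> short_verts i n) i n"
    by (simp_all add: short_out_def short_in_def)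
qed

lemma unmarked:
  "j < n \<Longrightarrow> Arm i j 0 \<notin> M \<Longrightarrow> Arm i j 1 \<notin> M \<Longrightarrow> arm_all L M i j = [:1, 2:]"
  "j < n \<Longrightarrow> Arm i j 0 \<notin> M \<Longrightarrow> Arm i j 1 \<notin> M \<Longrightarrow> arm_avoid L M i j = [:1, 1:]"
  by (simp_all add: arm out_def X_def one_pCons)

lemma marked_none:
  "short_out L {} i n = [:1, 2:] ^ n" "short_in L {} i n = X * [:1, 1:] ^ n"
  by (simp_all add: short_out_def short_in_def unmarked) (simp add: out_def)

lemma marked_branch:
  "short_out L {Branch i} i n = 0" "short_in L {Branch i} i n = X * [:1, 1:] ^ n"
  by (simp_all add: short_out_def short_in_def unmarked) (simp add: out_def)

text \<open>A marked vertex is chosen and excludes the other vertex of its arm, which leaves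
  \<open>X\<close>. If the chosen vertex is the one next to the branch, nothing avoids it.\<close>

lemma arm_marked:
  assumes "j < n" "p < 2"
  shows "arm_all L {Arm i j p} i j = X"
    and "arm_all L {Branch i, Arm i j p} i j = X"
    and "arm_avoid L {Arm i j p} i j = (if p = 0 then 0 else X)"
    and "arm_avoid L {Branch i, Arm i j p} i j = (if p = 0 then 0 else X)"
  using assms by (auto simp: arm out_def less_2_cases_iff)

lemma marked_arm:
  assumes "j < n" "p < 2"
  shows "short_out L {Arm i j p} i n = X * [:1, 2:] ^ (n - 1)"
    and "short_in L {Arm i j p} i n = X * ((if p = 0 then 0 else X) * [:1, 1:] ^ (n - 1))"
    and "short_out L {Branch i, Arm i j p} i n = 0"
    and "short_in L {Branch i, Arm i j p} i n = X * ((if p = 0 then 0 else X) * [:1, 1:] ^ (n - 1))"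
proof -
  have "(\<Prod>k<n. arm_all L {Arm i j p} i k) = arm_all L {Arm i j p} i j * [:1, 2:] ^ (card {..<n} - 1)"
    using assms(1) by (intro prod_except_one) (auto simp: unmarked)
  then show "short_out L {Arm i j p} i n = X * [:1, 2:] ^ (n - 1)"
    using assms by (simp add: short_out_def arm_marked) (simp add: out_def)
  have "(\<Prod>k<n. arm_avoid L M i k) = arm_avoid L M i j * [:1, 1:] ^ (card {..<n} - 1)"
    if "M = {Arm i j p} \<or> M = {Branch i, Arm i j p}" for M
    using assms(1) that by (intro prod_except_one) (auto simp: unmarked)
  then show "short_in L {Arm i j p} i n = X * ((if p = 0 then 0 else X) * [:1, 1:] ^ (n - 1))"
      "short_in L {Branch i, Arm i j p} i n = X * ((if p = 0 then 0 else X) * [:1, 1:] ^ (n - 1))"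
    using assms by (simp_all add: short_in_def arm_marked)
qed (simp add: short_out_def out_def)

lemma marked_arms:
  assumes "j < n" "p < 2" "k < n" "q < 2" "j \<noteq> k"
  shows "short_out L {Arm i j p, Arm i k q} i n = X * X * [:1, 2:] ^ (n - 2)"
    and "short_in L {Arm i j p, Arm i k q} i n =
      X * ((if p = 0 then 0 else X) * (if q = 0 then 0 else X) * [:1, 1:] ^ (n - 2))"
proof -
  have "arm_all L {Arm i j p, Arm i k q} i j = X" "arm_all L {Arm i j p, Arm i k q} i k = X"
    "arm_avoid L {Arm i j p, Arm i k q} i j = (if p = 0 then 0 else X)"
    "arm_avoid L {Arm i j p, Arm i k q} i k = (if q = 0 then 0 else X)"
    using assms by (auto simp: arm out_def less_2_cases_iff)
  moreover have "(\<Prod>l<n. arm_all L {Arm i j p, Arm i k q} i l) = arm_all L {Arm i j p, Arm i k q} i j *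
      arm_all L {Arm i j p, Arm i k q} i k * [:1, 2:] ^ (card {..<n} - 2)"
    using assms by (intro prod_except_two) (auto simp: unmarked)
  moreover have "(\<Prod>l<n. arm_avoid L {Arm i j p, Arm i k q} i l) = arm_avoid L {Arm i j p, Arm i k q} i j *
      arm_avoid L {Arm i j p, Arm i k q} i k * [:1, 1:] ^ (card {..<n} - 2)"
    using assms by (intro prod_except_two) (auto simp: unmarked)
  ultimately show "short_out L {Arm i j p, Arm i k q} i n = X * X * [:1, 2:] ^ (n - 2)"
      "short_in L {Arm i j p, Arm i k q} i n =
        X * ((if p = 0 then 0 else X) * (if q = 0 then 0 else X) * [:1, 1:] ^ (n - 2))"
    by (simp_all only: short_out_def short_in_def card_lessThan) (simp add: out_def)
qed

lemma marked_same_arm: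
  assumes "j < n" "p < 2" "q < 2" "p \<noteq> q"
  shows "short_out L {Arm i j p, Arm i j q} i n = 0"
    and "short_in L {Arm i j p, Arm i j q} i n = 0"
proof -
  have "arm_all L {Arm i j p, Arm i j q} i j = 0" "arm_avoid L {Arm i j p, Arm i j q} i j = 0"
    using assms by (auto simp: arm out_def less_2_cases_iff)
  with assms(1) show "short_out L {Arm i j p, Arm i j q} i n = 0"
      "short_in L {Arm i j p, Arm i j q} i n = 0"
    by (auto simp: short_out_def short_in_def intro!: prod_zero)
qed

lemma short_vertsE:
  assumes "v \<in> short_verts i n"
  obtains "v = Branch i" | j p where "v = Arm i j p" "j < n" "p < 2"
  using assms by (auto simp: short_verts_def)

text \<open>One mark lies on the branch vertex, an inner or an outer arm vertex. Two marks are
  adjacent, or on the branch vertex and an outer vertex, or on different arms; in the last case the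
  second component survives only if both are outer.\<close>

lemma short_arms_candidates:
  assumes "card (M \<inter> short_verts i n) \<le> 2"
  shows "(short_out L M i n, short_in L M i n) \<in>
    pair_polys (short_arms n) (card (M \<inter> short_verts i n))"
proof -
  define D where "D = M \<inter> short_verts i n"
  have D: "D \<subseteq> short_verts i n" "finite D"
    by (auto simp: D_def short_verts_def)
  note [simp] = pair_polys_def short_arms_def X_mult mult.assoc
  have "(short_out L D i n, short_in L D i n) \<in> pair_polys (short_arms n) (card D)"
  proof -
    consider "card D = 0" | "card D = 1" | "card D = 2"
      using assms unfolding D_def by linarith
    then show ?thesis
    proof cases
      case 1
      then have "D = {}"
        using D by simp
      then show ?thesis
        by (simp add: marked_none)
    next
      case 2
      then obtain v where v: "D = {v}"
        by (auto simp: card_1_singleton_iff)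
      with D have "v \<in> short_verts i n"
        by simp
      then show ?thesis
        by (cases rule: short_vertsE) (auto simp: v marked_branch marked_arm)
    next
      case 3
      then obtain v w where vw: "D = {v, w}" "v \<noteq> w"
        by (auto simp: card_2_iff)
      then have "v \<in> short_verts i n" "w \<in> short_verts i n"
        using D by auto
      then show ?thesis
      proof (elim short_vertsE)
        assume "v = Branch i" "w = Branch i"
        with vw show ?thesis
          by simp
      next
        fix j p assume "v = Branch i" "w = Arm i j p" "j < n" "p < 2"
        with 3 vw show ?thesis
          by (auto simp: marked_arm)
      next
        fix j p assume "w = Branch i" "v = Arm i j p" "j < n" "p < 2"
        with 3 vw show ?thesis
          by (auto simp: marked_arm insert_commute[of _ "Branch i"])
      next
        fix j p k q assume *: "v = Arm i j p" "j < n" "p < 2" "w = Arm i k q" "k < n" "q < 2"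
        show ?thesis
        proof (cases "j = k")
          case True
          with * 3 vw show ?thesis
            by (auto simp: marked_same_arm)
        next
          case False
          with * 3 vw show ?thesis
            by (auto simp: marked_arms)
        qed
      qed
    qed
  qed
  then show ?thesis
    by (simp only: D_def restrict[of M])
qed

end

section \<open>From the branches to the whole tree\<close>

definition candidates :: "(int list \<times> int list) graded \<Rightarrow> nat list list \<Rightarrow> nat \<Rightarrow> bool" where
  "candidates G L i \<longleftrightarrow> (\<forall>M. card (M \<inter> branch_verts L i) \<le> 2 \<longrightarrow>
     (branch_out L M i, branch_in L M i) \<in> pair_polys G (card (M \<inter> branch_verts L i)))"

lemma short_branch_factors:
  assumes "i < length L" "L ! i = replicate n 2"
  shows "short_branch L i n" and "branch_verts L i = short_verts i n"
    and "branch_out L M i = short_out L M i n" and "branch_in L M i = short_in L M i n"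
  using assms
  by (simp_all add: short_branch_def branch_verts_def short_verts_def arm_verts_short
      branch_out_def short_out_def branch_in_def short_in_def)

lemma candidates_short_arms:
  assumes "i < length L" "L ! i = replicate n 2"
  shows "candidates (short_arms n) L i"
  unfolding candidates_def short_branch_factors[OF assms]
  using short_branch.short_arms_candidates[OF short_branch_factors(1)[OF assms]] by blast

lemma pair_polys_combine:
  assumes "(p, q) \<in> pair_polys G s" "(p', q') \<in> pair_polys H t" "s + t \<le> 2"
  shows "(p * p', q * q') \<in> pair_polys (combine mult_pair G H) (s + t)"
proof -
  obtain x y where xy: "x \<in> set (grade s G)" "(p, q) = map_prod Poly Poly x"
      "y \<in> set (grade t H)" "(p', q') = map_prod Poly Poly y"
    using assms(1,2) unfolding pair_polys_def by (elim imageE)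
  have "(p * p', q * q') = map_prod Poly Poly (mult_pair x y)"
    using xy(2,4) by (simp add: mult_pair_def prod_eq_iff)
  then show ?thesis
    unfolding pair_polys_def using grade_combine[OF xy(1,3) assms(3)] by (rule image_eqI)
qed

lemma pair_polys_total:
  assumes "(p, q) \<in> pair_polys G t"
  shows "(p + q, p) \<in> pair_polys (map_graded total_pair G) t"
proof -
  obtain x where x: "x \<in> set (grade t G)" "(p, q) = map_prod Poly Poly x"
    using assms unfolding pair_polys_def by (elim imageE)
  have "(p + q, p) = map_prod Poly Poly (total_pair x)"
    using x(2) by (simp add: total_pair_def prod_eq_iff)
  then show ?thesis
    unfolding pair_polys_def using grade_map_graded[OF x(1)] by (rule image_eqI)
qed

lemma candidates_star_arms:
  assumes "i < length L" "L ! i = [2, 2, 4]"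
  shows "candidates star_arms L i"
  unfolding candidates_def
proof (intro allI impI)
  fix M assume card: "card (M \<inter> branch_verts L i) \<le> 2"
  \<comment> \<open>Arms 0 and 1 are the short ones; arm 2 is the pendant \<open>P\<^sub>4\<close>
    and is split off.\<close>
  interpret short_branch L i 2
    using assms by unfold_locales (auto simp: less_2_cases_iff)
  have V: "branch_verts L i = short_verts i 2 \<union> arm_verts L i 2"
    using assms by (auto simp: branch_verts_def short_verts_def arm_verts_def lessThan_Suc
        numeral_3_eq_3 numeral_2_eq_2)
  have "(M \<inter> short_verts i 2) \<inter> (M \<inter> arm_verts L i 2) = {}"
    by (auto simp: short_verts_def arm_verts_def)
  moreover have "finite (M \<inter> short_verts i 2)"
    by (simp add: short_verts_def)
  ultimately have c: "card (M \<inter> branch_verts L i) =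
      card (M \<inter> short_verts i 2) + card (M \<inter> arm_verts L i 2)"
    by (simp add: V Int_Un_distrib card_Un_disjoint)
  have "branch_out L M i = short_out L M i 2 * arm_all L M i 2"
    "branch_in L M i = short_in L M i 2 * arm_avoid L M i 2"
    using assms by (simp_all add: branch_out_def branch_in_def short_out_def short_in_def
        lessThan_Suc numeral_3_eq_3 numeral_2_eq_2 ac_simps)
  then show "(branch_out L M i, branch_in L M i) \<in> pair_polys star_arms (card (M \<inter> branch_verts L i))"
    using card assms unfolding star_arms_def c
    by (auto intro!: pair_polys_combine short_arms_candidates long_arm_candidates)
qed

lemma ipoly_three_branches:
  assumes "length L = 3"
  shows "ipoly (arm_tree L) M =
    out M Root * ((branch_out L M 0 + branch_in L M 0) * ((branch_out L M 1 + branch_in L M 1) *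
      (branch_out L M 2 + branch_in L M 2))) +
    X * (branch_out L M 0 * (branch_out L M 1 * branch_out L M 2))"
  using assms by (simp add: ipoly_arm_tree lessThan_Suc numeral_3_eq_3 numeral_2_eq_2 ac_simps)

text \<open>The root and the three branches partition the vertices, so their numbers of marks add
  up. Each branch supplies a candidate for its own number, and \<open>combine\<close> runs through
  all distributions.\<close>

lemma ipoly_candidates:
  assumes L: "L = [l, replicate m 2, replicate n 2]" and G: "candidates G L 0"
    and M: "M \<subseteq> verts (arm_tree L)" "card M \<le> 2"
  shows "ipoly (arm_tree L) M \<in> Poly ` set (grade (card M) (tree_polys G m n))"
proof -
  define R where "R = M \<inter> {Root}"
  define B where "B i = M \<inter> branch_verts L i" for i
  have fin: "finite R" "finite (B i)" for i
    by (simp_all add: R_def B_def)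
  have disj: "B i \<inter> B j = {}" if "i \<noteq> j" for i j
    using that by (auto simp: B_def branch_verts_def arm_verts_def)
  have disjR: "R \<inter> B i = {}" for i
    by (auto simp: R_def B_def branch_verts_def arm_verts_def)
  have len: "length L = 3"
    by (simp add: L)
  have "{..<length L} = {0, 1, 2}"
    by (auto simp: len)
  then have "M = R \<union> (B 0 \<union> (B 1 \<union> B 2))"
    using M(1) unfolding verts_arm_tree R_def B_def by auto
  then have card: "card M = card R + (card (B 0) + (card (B 1) + card (B 2)))"
    by (simp add: card_Un_disjoint fin disj disjR Int_Un_distrib)
  have "candidates (short_arms m) L 1" "candidates (short_arms n) L 2"
    by (rule candidates_short_arms; simp add: L)+
  then have "(branch_out L M 0, branch_in L M 0) \<in> pair_polys G (card (B 0))"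
      "(branch_out L M 1, branch_in L M 1) \<in> pair_polys (short_arms m) (card (B 1))"
      "(branch_out L M 2, branch_in L M 2) \<in> pair_polys (short_arms n) (card (B 2))"
    using G M(2) card unfolding candidates_def B_def by simp_all
  then have "((branch_out L M 0 + branch_in L M 0) * ((branch_out L M 1 + branch_in L M 1) *
      (branch_out L M 2 + branch_in L M 2)),
      branch_out L M 0 * (branch_out L M 1 * branch_out L M 2)) \<in>
    pair_polys (combine mult_pair (map_graded total_pair G)
       (combine mult_pair (map_graded total_pair (short_arms m))
         (map_graded total_pair (short_arms n)))) (card (B 0) + (card (B 1) + card (B 2)))"
    (is "(?Y, ?Q) \<in> pair_polys ?H ?t")
    using M(2) card by (intro pair_polys_combine pair_polys_total) simp_all
  then obtain y where y: "y \<in> set (grade ?t ?H)" "(?Y, ?Q) = map_prod Poly Poly y"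
    unfolding pair_polys_def by (elim imageE)
  have r: "(Root \<notin> M) \<in> set (grade (card R) ([True], [False], []))"
    by (cases "Root \<in> M") (simp_all add: R_def)
  have "ipoly (arm_tree L) M = Poly (root_poly (Root \<notin> M) y)"
    using y(2) unfolding ipoly_three_branches[OF len]
    by (cases y) (simp add: root_poly_def out_def X_mult)
  then show ?thesis
    using grade_combine[OF r y(1), of root_poly] M(2)
    unfolding card tree_polys_def by (simp del: grade.simps)
qed

section \<open>Adding an edge to a tree\<close>

lemma unimodal_add_edge:
  assumes "L = [l, replicate m 2, replicate n 2]" "candidates G L 0"
    and "check_unimodal (tree_polys G m n)" "nonedge (arm_tree L) u v"
  shows "unimodal (indep_poly (add_edge (arm_tree L) u v))"
proof -
  obtain fs gs hs where P: "tree_polys G m n = (fs, gs, hs)"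
    by (cases "tree_polys G m n")
  have "{u, v} \<subseteq> verts (arm_tree L)" "card {u, v} = 2"
    using assms(4) by (auto simp: nonedge_def)
  \<comment> \<open>\<open>f\<close> belongs to no marks and \<open>h\<close> to the marks
    \<open>u\<close> and \<open>v\<close>. Whichever candidates these are, the check has tested
    their difference.\<close>
  then obtain f h where "f \<in> set fs" "ipoly (arm_tree L) {} = Poly f"
      "h \<in> set hs" "ipoly (arm_tree L) {u, v} = Poly h"
    using ipoly_candidates[OF assms(1,2), of "{}"] ipoly_candidates[OF assms(1,2), of "{u, v}"]
    by (auto simp: P)
  then have "map_poly int (indep_poly (add_edge (arm_tree L) u v)) = Poly (diff_list f h)"
      "unimodal_list (diff_list f h)"
    using assms(3,4) by (auto simp: indep_poly_add_edge P list_all_iff)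
  then show ?thesis
    by (rule unimodal_of_list)
qed

lemma log_concave_add_edge:
  assumes L: "L = [l, replicate m 2, replicate n 2]" and G: "candidates G L 0"
    and check: "check_log_concave m n G (tree_polys G m n)"
  shows "\<not> log_concave (indep_poly (arm_tree L))"
    and "nonedge (arm_tree L) (Branch 1) (Branch 2)"
    and "log_concave (indep_poly (add_edge (arm_tree L) (Branch 1) (Branch 2)))"
proof -
  obtain fs gs hs where P: "tree_polys G m n = (fs, gs, hs)"
    by (cases "tree_polys G m n")
  obtain ps qs rs where Q: "G = (ps, qs, rs)"
    by (cases G)
  have check': "check_log_concave m n (ps, qs, rs) (fs, gs, hs)"
    using check unfolding P unfolding Q .
  let ?M = "{Branch 1, Branch 2}"
  have len: "length L = 3" and nth: "L ! 1 = replicate m 2" "L ! 2 = replicate n 2"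
    by (simp_all add: L)
  obtain f where f: "f \<in> set fs" "ipoly (arm_tree L) {} = Poly f"
    using ipoly_candidates[OF L G, of "{}"] by (auto simp: P)
  show nonedge: "nonedge (arm_tree L) (Branch 1) (Branch 2)"
    by (auto simp: nonedge_def edges_arm_tree_simps verts_arm_tree branch_verts_def L)
  have "?M \<inter> branch_verts L 0 = {}"
    by (auto simp: branch_verts_def arm_verts_def)
  then have "(branch_out L ?M 0, branch_in L ?M 0) \<in> pair_polys G 0"
    using G unfolding candidates_def by (metis card.empty zero_le)
  then obtain p where p: "p \<in> set ps" "branch_out L ?M 0 = Poly (fst p)" "branch_in L ?M 0 = Poly (snd p)"
    by (auto simp: pair_polys_def Q)
  \<comment> \<open>A marked branch vertex must be chosen: the sum avoiding it is 0, and each of its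
    arms keeps only its outer vertex, with factor \<open>[:1, 1:]\<close>.\<close>
  have B: "branch_out L ?M i = 0" "branch_in L ?M i = X * [:1, 1:] ^ k"
    if "i < length L" "L ! i = replicate k 2" "i \<in> {1, 2}" for i k
  proof -
    interpret short_branch L i k
      using that by (intro short_branch_factors)
    have "?M \<inter> short_verts i k = {Branch i}"
      using that(3) by (auto simp: short_verts_def)
    then show "branch_out L ?M i = 0" "branch_in L ?M i = X * [:1, 1:] ^ k"
      using that restrict[of ?M] by (simp_all add: short_branch_factors marked_branch)
  qed
  \<comment> \<open>The root is adjacent to both marks and hence absent, which leaves branch 0
    unrestricted. The two chosen branch vertices give \<open>0 # 0\<close>.\<close>
  have "ipoly (arm_tree L) ?M = Poly (0 # 0 # mult_list (fst (total_pair p))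
      (mult_list (power_list [1, 1] m) (power_list [1, 1] n)))"
    using B[of 1 m] B[of 2 n] unfolding ipoly_three_branches[OF len]
    by (simp add: len nth p total_pair_def out_def X_mult algebra_simps del: One_nat_def)
  with f have "map_poly int (indep_poly (add_edge (arm_tree L) (Branch 1) (Branch 2))) =
      Poly (diff_list f (0 # 0 # mult_list (fst (total_pair p))
        (mult_list (power_list [1, 1] m) (power_list [1, 1] n))))"
    using nonedge by (simp add: indep_poly_add_edge)
  from log_concave_of_list[OF this]
  show "log_concave (indep_poly (add_edge (arm_tree L) (Branch 1) (Branch 2)))"
    using check' f(1) p(1) by (simp only: check_log_concave.simps list_all_iff)
  have "map_poly int (indep_poly (arm_tree L)) = Poly f"
    using f by (simp add: indep_poly_eq_ipoly)
  then show "\<not> log_concave (indep_poly (arm_tree L))"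
    using check' f(1) by (simp add: log_concave_of_list list_all_iff)
qed

section \<open>The seven collections\<close>

lemma candidates_T3: "candidates (short_arms 3) [[2, 2, 2], replicate m 2, replicate n 2] 0"
  by (rule candidates_short_arms) (simp_all add: numeral_3_eq_3)

lemma candidates_T3_star: "candidates star_arms [[2, 2, 4], replicate m 2, replicate n 2] 0"
  by (rule candidates_star_arms) simp_all

text \<open>The tree with the smallest parameter \<open>a\<close> is the witness: it is not
  log-concave itself, but becomes so when \<open>Branch 1\<close> and \<open>Branch 2\<close> are
  joined.\<close>

lemma collection:
  assumes T: "\<And>k. T k = arm_tree [l, replicate (m k) 2, replicate (n k) 2]"
    and G: "\<And>m n. candidates G [l, replicate m 2, replicate n 2] 0"
    and check: "check_all G (map (\<lambda>k. (m k, n k)) [a..<Suc b])" "a \<le> b"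
    and witness: "check_log_concave (m a) (n a) G (tree_polys G (m a) (n a))"
  shows "(\<forall>T'\<in>{T k | k. a \<le> k \<and> k \<le> b}. \<forall>u v. nonedge T' u v \<longrightarrow>
       unimodal (indep_poly (add_edge T' u v))) \<and>
     (\<exists>T'\<in>{T k | k. a \<le> k \<and> k \<le> b}. \<not> log_concave (indep_poly T') \<and>
        (\<exists>u v. nonedge T' u v \<and> log_concave (indep_poly (add_edge T' u v))))"
proof (intro conjI ballI allI impI bexI)
  show "T a \<in> {T k | k. a \<le> k \<and> k \<le> b}"
    using check(2) by blast
  show "\<not> log_concave (indep_poly (T a))"
      "\<exists>u v. nonedge (T a) u v \<and> log_concave (indep_poly (add_edge (T a) u v))"
    using log_concave_add_edge[OF refl G witness] unfolding T by blast+
next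
  fix T' u v assume "T' \<in> {T k | k. a \<le> k \<and> k \<le> b}" "nonedge T' u v"
  then show "unimodal (indep_poly (add_edge T' u v))"
    using check(1) unimodal_add_edge[OF refl G]
    by (auto simp: check_all_iff T less_Suc_eq_le simp del: upt_Suc)
qed

lemmas T3_collection =
  collection[where T = "\<lambda>k. T3 (m k) (n k)" and m = m and n = n, OF T3_def candidates_T3] for m n

lemmas T3_star_collection =
  collection[where T = "\<lambda>k. T3_star (m k) (n k)" and m = m and n = n,
    OF T3_star_def candidates_T3_star] for m n

section \<open>Evaluation for the seven collections\<close>

lemma check_a:
  "check_all (short_arms 3) (map (\<lambda>k. (k, k)) [4..<Suc 12])"
  by code_simp

lemma witness_a:
  "check_log_concave 4 4 (short_arms 3) (tree_polys (short_arms 3) 4 4)"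
  by code_simp

lemma check_b:
  "check_all (short_arms 3) (map (\<lambda>k. (k, k + 1)) [4..<Suc 9])"
  by code_simp

lemma witness_b:
  "check_log_concave 4 (4 + 1) (short_arms 3) (tree_polys (short_arms 3) 4 (4 + 1))"
  by code_simp

lemma check_c:
  "check_all (short_arms 3) (map (\<lambda>k. (k, k + 2)) [4..<Suc 9])"
  by code_simp

lemma witness_c:
  "check_log_concave 4 (4 + 2) (short_arms 3) (tree_polys (short_arms 3) 4 (4 + 2))"
  by code_simp

lemma check_d:
  "check_all star_arms (map (\<lambda>k. (k, k + 1)) [3..<Suc 8])"
  by code_simp

lemma witness_d:
  "check_log_concave 3 (3 + 1) star_arms (tree_polys star_arms 3 (3 + 1))"
  by code_simp

lemma check_e:
  "check_all star_arms (map (\<lambda>k. (k - 1, k + 1)) [4..<Suc 9])"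
  by code_simp

lemma witness_e:
  "check_log_concave (4 - 1) (4 + 1) star_arms (tree_polys star_arms (4 - 1) (4 + 1))"
  by code_simp

lemma check_f:
  "check_all star_arms (map (\<lambda>k. (k, k)) [4..<Suc 9])"
  by code_simp

lemma witness_f:
  "check_log_concave 4 4 star_arms (tree_polys star_arms 4 4)"
  by code_simp

lemma check_g:
  "check_all star_arms (map (\<lambda>k. (k, k + 3)) [4..<Suc 9])"
  by code_simp

lemma witness_g:
  "check_log_concave 4 (4 + 3) star_arms (tree_polys star_arms 4 (4 + 3))"
  by code_simp

theorem theorem5p2:
  shows "\<forall>C \<in> {{T3 k k | k. 4 \<le> k \<and> k \<le> 12},
               {T3 k (k + 1) | k. 4 \<le> k \<and> k \<le> 9},
               {T3 k (k + 2) | k. 4 \<le> k \<and> k \<le> 9},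
               {T3_star k (k + 1) | k. 3 \<le> k \<and> k \<le> 8},
               {T3_star (k - 1) (k + 1) | k. 4 \<le> k \<and> k \<le> 9},
               {T3_star k k | k. 4 \<le> k \<and> k \<le> 9},
               {T3_star k (k + 3) | k. 4 \<le> k \<and> k \<le> 9}}.
     (\<forall>T\<in>C. \<forall>u v. nonedge T u v \<longrightarrow> unimodal (indep_poly (add_edge T u v))) \<and>
     (\<exists>T\<in>C. \<not> log_concave (indep_poly T) \<and>
        (\<exists>u v. nonedge T u v \<and> log_concave (indep_poly (add_edge T u v))))"
  apply (intro ballI, elim insertE emptyE; hypsubst)
  apply (rule T3_collection[where m = "\<lambda>k. k" and n = "\<lambda>k. k", OF check_a _ witness_a]; simp)
  apply (rule T3_collection[where m = "\<lambda>k. k" and n = "\<lambda>k. k + 1", OF check_b _ witness_b]; simp)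
  apply (rule T3_collection[where m = "\<lambda>k. k" and n = "\<lambda>k. k + 2", OF check_c _ witness_c]; simp)
  apply (rule T3_star_collection[where m = "\<lambda>k. k" and n = "\<lambda>k. k + 1", OF check_d _ witness_d]; simp)
  apply (rule T3_star_collection[where m = "\<lambda>k. k - 1" and n = "\<lambda>k. k + 1", OF check_e _ witness_e]; simp)
  apply (rule T3_star_collection[where m = "\<lambda>k. k" and n = "\<lambda>k. k", OF check_f _ witness_f]; simp)
  apply (rule T3_star_collection[where m = "\<lambda>k. k" and n = "\<lambda>k. k + 3", OF check_g _ witness_g]; simp)
  done

end
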